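(* If $p\ge1$, then the radial maximal Hardy space $H^p(B(\mathcal{X})^n_1)$, with the norm $\|\cdot\|_p$, is a Banach space.
   Context: $\mathbb{F}_n^+$ is the unital free semigroup on generators $g_1,\ldots,g_n$ with identity $g_0$; $|\alpha|$ is word length; $X_\alpha:=X_{i_1}\cdots X_{i_k}$ if $\alpha=g_{i_1}\cdots g_{i_k}$, $X_{g_0}:=I$. $Hol(B(\mathcal{X})^n_1)$ (free holomorphic functions on the open operatorial unit $n$-ball with scalar coefficients) is the set of formal power series $F=\sum_\alpha a_\alpha Z_\alpha$, $a_\alpha\in\mathbb{C}$, in noncommuting indeterminates with $\limsup_{k\to\infty}(\sum_{|\alpha|=k}|a_\alpha|^2)^{1/2k}\le1$; then $F(X_1,\ldots,X_n):=\sum_{k=0}^\infty\sum_{|\alpha|=k}a_\alpha X_\alpha$ converges in norm for operators on a Hilbert space with $\|\sum_iX_iX_i^*\|<1$. $S_1,\ldots,S_n$ are the left creation operators $S_i\xi:=e_i\otimes\xi$ on the full Fock space $F^2(H_n)=\mathbb{C}1\oplus\bigoplus_{m\ge1}H_n^{\otimes m}$, $H_n$ an $n$-dimensional Hilbert space with orthonormal basis $e_1,\ldots,e_n$. The radial maximal function of $F$ is $M_F(r):=\|F(rS_1,\ldots,rS_n)\|$, $r\in[0,1)$. For $p\ge1$ (real), $H^p(B(\mathcal{X})^n_1)$ is the set of $F\in Hol(B(\mathcal{X})^n_1)$ with $M_F\in L^p[0,1]$, normed by $\|F\|_p:=\big(\int_0^1\|F(rS_1,\ldots,rS_n)\|^p\,dr\big)^{1/p}$.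 *)

theory Defs
  imports "HOL-Analysis.Analysis" "HOL-Library.Function_Algebras"
begin

text \<open>The norm is only constrained on the carrier \<open>V\<close>, which is a linear subspace of an
  ambient complex vector space.\<close>

locale complex_banach_space_on = vector_space scale
  for scale :: "complex \<Rightarrow> 'v::ab_group_add \<Rightarrow> 'v" +
  fixes V :: "'v set" and N :: "'v \<Rightarrow> real"
  assumes subspace_carrier: "subspace V"
    and N_nonneg: "x \<in> V \<Longrightarrow> 0 \<le> N x"
    and N_eq_0_iff: "x \<in> V \<Longrightarrow> N x = 0 \<longleftrightarrow> x = 0"
    and N_scale: "x \<in> V \<Longrightarrow> N (scale c x) = cmod c * N x"
    and N_triangle: "x \<in> V \<Longrightarrow> y \<in> V \<Longrightarrow> N (x + y) \<le> N x + N y"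
    and complete: "(\<And>k. \<sigma> k \<in> V) \<Longrightarrow>
        (\<And>e. e > 0 \<Longrightarrow> \<exists>K. \<forall>k\<ge>K. \<forall>m\<ge>K. N (\<sigma> k - \<sigma> m) < e) \<Longrightarrow>
        \<exists>x\<in>V. (\<lambda>k. N (\<sigma> k - x)) \<longlonglongrightarrow> 0"

text \<open>
  The free semigroup on the generators indexed by \<open>'n\<close> is \<open>'n list\<close>, with \<open>[]\<close> as its identity and
  \<open>length\<close> as word length. The tensors \<open>e\<^sub>\<alpha> = e\<^bsub>i1\<^esub> \<otimes> \<dots> \<otimes> e\<^bsub>ik\<^esub>\<close> with \<open>\<alpha> = [i1, \<dots>, ik]\<close>
  form an orthonormal basis of the \<open>k\<close>-th tensor power of \<open>H\<^sub>n\<close> (for \<open>k = 0\<close> this is the vacuum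
  vector 1), so a vector of the full Fock space is given by its square-summable family of
  coordinates in the basis \<open>(e\<^sub>\<alpha>)\<close>.
\<close>

typedef 'n fock = "{f :: 'n list \<Rightarrow> complex. (\<lambda>w. (cmod (f w))\<^sup>2) summable_on UNIV}"
  morphisms coord Abs_fock
  by (rule exI[of _ "\<lambda>_. 0"]) simp

setup_lifting type_definition_fock

lemma fock_eqI: "(\<And>w. coord x w = coord y w) \<Longrightarrow> x = y"
  by (simp add: coord_inject[symmetric] fun_eq_iff)

lemma coord_summable: "(\<lambda>w. (cmod (coord x w))\<^sup>2) summable_on UNIV"
  using coord by auto

lemma ell2_dominated:
  fixes f :: "'a \<Rightarrow> real"
  assumes "g summable_on A" "\<And>x. x \<in> A \<Longrightarrow> \<bar>f x\<bar> \<le> g x"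
  shows "f summable_on A"
proof -
  have "(\<lambda>x. norm (f x)) summable_on A"
    by (rule summable_on_comparison_test[OF assms(1)]) (use assms(2) in auto)
  then show ?thesis
    by (rule abs_summable_summable)
qed

lemma ell2_add:
  fixes f g :: "'a \<Rightarrow> complex"
  assumes "(\<lambda>w. (cmod (f w))\<^sup>2) summable_on A" "(\<lambda>w. (cmod (g w))\<^sup>2) summable_on A"
  shows "(\<lambda>w. (cmod (f w + g w))\<^sup>2) summable_on A"
proof (rule ell2_dominated)
  show "(\<lambda>w. 2 * (cmod (f w))\<^sup>2 + 2 * (cmod (g w))\<^sup>2) summable_on A"
    by (intro summable_on_add summable_on_cmult_right assms)
  fix w
  have "(cmod (f w + g w))\<^sup>2 \<le> (cmod (f w) + cmod (g w))\<^sup>2"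
    by (intro power_mono norm_triangle_ineq) simp
  also have "\<dots> \<le> 2 * (cmod (f w))\<^sup>2 + 2 * (cmod (g w))\<^sup>2"
    using sum_squares_bound[of "cmod (f w)" "cmod (g w)"] by (simp add: power2_sum)
  finally show "\<bar>(cmod (f w + g w))\<^sup>2\<bar> \<le> 2 * (cmod (f w))\<^sup>2 + 2 * (cmod (g w))\<^sup>2"
    by simp
qed

lemma ell2_scale:
  fixes f :: "'a \<Rightarrow> complex"
  assumes "(\<lambda>w. (cmod (f w))\<^sup>2) summable_on A"
  shows "(\<lambda>w. (cmod (c * f w))\<^sup>2) summable_on A"
  using summable_on_cmult_right[OF assms, of "(cmod c)\<^sup>2"]
  by (simp add: norm_mult power_mult_distrib)

lemma ell2_inner_summable:
  fixes f g :: "'a \<Rightarrow> complex"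
  assumes "(\<lambda>w. (cmod (f w))\<^sup>2) summable_on A" "(\<lambda>w. (cmod (g w))\<^sup>2) summable_on A"
  shows "(\<lambda>w. Re (f w * cnj (g w))) summable_on A"
proof (rule ell2_dominated)
  show "(\<lambda>w. (cmod (f w))\<^sup>2 + (cmod (g w))\<^sup>2) summable_on A"
    by (intro summable_on_add assms)
  fix w
  have "\<bar>Re (f w * cnj (g w))\<bar> \<le> cmod (f w) * cmod (g w)"
    using abs_Re_le_cmod[of "f w * cnj (g w)"] by (simp add: norm_mult)
  moreover have "0 \<le> cmod (f w) * cmod (g w)"
    by simp
  moreover have "2 * (cmod (f w) * cmod (g w)) \<le> (cmod (f w))\<^sup>2 + (cmod (g w))\<^sup>2"
    using sum_squares_bound[of "cmod (f w)" "cmod (g w)"] by (simp only: mult.assoc)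
  ultimately show "\<bar>Re (f w * cnj (g w))\<bar> \<le> (cmod (f w))\<^sup>2 + (cmod (g w))\<^sup>2"
    by linarith
qed

text \<open>The type classes provide the underlying real Hilbert space; its norm is the Hilbert space
  norm, and its inner product is the real part of the complex one.\<close>

instantiation fock :: (type) real_inner
begin

lift_definition zero_fock :: "'a fock" is "\<lambda>_. 0" by simp

lift_definition plus_fock :: "'a fock \<Rightarrow> 'a fock \<Rightarrow> 'a fock" is "\<lambda>f g w. f w + g w"
  by (rule ell2_add)

lift_definition uminus_fock :: "'a fock \<Rightarrow> 'a fock" is "\<lambda>f w. - f w" by simp

lift_definition minus_fock :: "'a fock \<Rightarrow> 'a fock \<Rightarrow> 'a fock" is "\<lambda>f g w. f w - g w"
proof -
  fix f g :: "'a list \<Rightarrow> complex"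
  assume "(\<lambda>w. (cmod (f w))\<^sup>2) summable_on UNIV" "(\<lambda>w. (cmod (g w))\<^sup>2) summable_on UNIV"
  then show "(\<lambda>w. (cmod (f w - g w))\<^sup>2) summable_on UNIV"
    using ell2_add[of f UNIV "\<lambda>w. - g w"] by simp
qed

lift_definition scaleR_fock :: "real \<Rightarrow> 'a fock \<Rightarrow> 'a fock" is "\<lambda>r f w. complex_of_real r * f w"
  by (rule ell2_scale)

definition inner_fock :: "'a fock \<Rightarrow> 'a fock \<Rightarrow> real" where
  "inner_fock x y = (\<Sum>\<^sub>\<infinity>w. Re (coord x w * cnj (coord y w)))"

definition norm_fock :: "'a fock \<Rightarrow> real" where
  "norm_fock x = sqrt (\<Sum>\<^sub>\<infinity>w. (cmod (coord x w))\<^sup>2)"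

definition dist_fock :: "'a fock \<Rightarrow> 'a fock \<Rightarrow> real" where
  "dist_fock x y = norm (x - y)"

definition sgn_fock :: "'a fock \<Rightarrow> 'a fock" where
  "sgn_fock x = inverse (norm x) *\<^sub>R x"

definition uniformity_fock :: "('a fock \<times> 'a fock) filter" where
  "uniformity_fock = (INF e\<in>{0<..}. principal {(x, y). dist x y < e})"

definition open_fock :: "'a fock set \<Rightarrow> bool" where
  "open_fock U \<longleftrightarrow> (\<forall>x\<in>U. eventually (\<lambda>(x', y). x' = x \<longrightarrow> y \<in> U) uniformity)"

instance
proof
  fix x y z :: "'a fock" and a b r :: real
  show "x + y + z = x + (y + z)" "x + y = y + x" "0 + x = x" "- x + x = 0" "x - y = x + - y"
    "a *\<^sub>R (x + y) = a *\<^sub>R x + a *\<^sub>R y" "(a + b) *\<^sub>R x = a *\<^sub>R x + b *\<^sub>R x"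
    "a *\<^sub>R b *\<^sub>R x = (a * b) *\<^sub>R x" "1 *\<^sub>R x = x"
    by (transfer; simp add: algebra_simps)+
  show "dist x y = norm (x - y)" "sgn x = inverse (norm x) *\<^sub>R x"
    by (simp_all add: dist_fock_def sgn_fock_def)
  show "uniformity = (INF e\<in>{0<..}. principal {(x, y :: 'a fock). dist x y < e})"
    by (rule uniformity_fock_def)
  show "open U = (\<forall>x\<in>U. eventually (\<lambda>(x', y). x' = x \<longrightarrow> y \<in> U) uniformity)" for U :: "'a fock set"
    by (rule open_fock_def)
  have self: "inner x x = (\<Sum>\<^sub>\<infinity>w. (cmod (coord x w))\<^sup>2)" for x :: "'a fock"
    by (simp add: inner_fock_def cmod_def power2_eq_square)
  show "inner x y = inner y x"
    by (simp add: inner_fock_def mult.commute)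
  show "inner (x + y) z = inner x z + inner y z"
    unfolding inner_fock_def plus_fock.rep_eq
    by (subst infsum_add[symmetric])
      (simp_all only: ell2_inner_summable coord_summable distrib_right plus_complex.sel)
  show "inner (r *\<^sub>R x) y = r * inner x y"
    unfolding inner_fock_def scaleR_fock.rep_eq
    by (subst infsum_cmult_right'[symmetric]) (simp add: algebra_simps)
  show "0 \<le> inner x x"
    unfolding self by (rule infsum_nonneg) simp
  show "inner x x = 0 \<longleftrightarrow> x = 0"
  proof
    assume "inner x x = 0"
    then have "(cmod (coord x w))\<^sup>2 = 0" for w
      unfolding self by (intro nonneg_infsum_le_0D[OF _ coord_summable]) auto
    then show "x = 0"
      by (intro fock_eqI) (simp add: zero_fock.rep_eq)
  next
    assume "x = 0"
    then show "inner x x = 0"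
      by (simp add: self zero_fock.rep_eq)
  qed
  show "norm x = sqrt (inner x x)"
    by (simp add: self norm_fock_def)
qed

end

lemma sum_coord_le_norm:
  assumes "finite A"
  shows "(\<Sum>w\<in>A. (cmod (coord x w))\<^sup>2) \<le> (norm x)\<^sup>2"
proof -
  have "(norm x)\<^sup>2 = (\<Sum>\<^sub>\<infinity>w. (cmod (coord x w))\<^sup>2)"
    by (simp add: norm_fock_def infsum_nonneg)
  then show ?thesis
    using finite_sum_le_infsum[OF coord_summable assms] by simp
qed

lemma norm_fock_le:
  assumes "\<And>A. finite A \<Longrightarrow> (\<Sum>w\<in>A. (cmod (coord x w))\<^sup>2) \<le> e\<^sup>2" "0 \<le> e"
  shows "norm x \<le> e"
proof -
  have "(\<Sum>\<^sub>\<infinity>w. (cmod (coord x w))\<^sup>2) \<le> e\<^sup>2"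
    by (rule infsum_le_finite_sums[OF coord_summable]) (use assms in auto)
  then show ?thesis
    unfolding norm_fock_def using assms(2) by (simp add: real_le_lsqrt)
qed

instance fock :: (type) banach
proof
  fix X :: "nat \<Rightarrow> 'a fock"
  assume C: "Cauchy X"
  have coord_le: "cmod (coord x w) \<le> norm x" for x :: "'a fock" and w
    by (rule power2_le_imp_le) (use sum_coord_le_norm[of "{w}" x] in simp_all)
  have "Cauchy (\<lambda>k. coord (X k) w)" for w
    unfolding Cauchy_def
  proof (intro allI impI)
    fix e :: real
    assume "e > 0"
    then obtain K where K: "\<forall>m\<ge>K. \<forall>n\<ge>K. dist (X m) (X n) < e"
      using C unfolding Cauchy_def by blast
    have "dist (coord (X m) w) (coord (X n) w) \<le> dist (X m) (X n)" for m n
      using coord_le[of "X m - X n" w] by (simp add: dist_norm minus_fock.rep_eq)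
    then show "\<exists>K. \<forall>m\<ge>K. \<forall>n\<ge>K. dist (coord (X m) w) (coord (X n) w) < e"
      using K le_less_trans by blast
  qed
  then have "\<exists>l. (\<lambda>k. coord (X k) w) \<longlonglongrightarrow> l" for w
    using Cauchy_convergent convergent_def by blast
  then obtain L where L: "\<And>w. (\<lambda>k. coord (X k) w) \<longlonglongrightarrow> L w"
    by metis
  have bound: "\<exists>K. \<forall>m\<ge>K. \<forall>A. finite A \<longrightarrow> (\<Sum>w\<in>A. (cmod (coord (X m) w - L w))\<^sup>2) \<le> e\<^sup>2"
    if "e > 0" for e :: real
  proof -
    obtain K where K: "\<forall>m\<ge>K. \<forall>n\<ge>K. dist (X m) (X n) < e"
      using C \<open>e > 0\<close> unfolding Cauchy_def by blast
    have "(\<Sum>w\<in>A. (cmod (coord (X m) w - L w))\<^sup>2) \<le> e\<^sup>2" if "m \<ge> K" "finite A" for m A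
    proof (rule LIMSEQ_le_const2)
      show "(\<lambda>n. \<Sum>w\<in>A. (cmod (coord (X m) w - coord (X n) w))\<^sup>2)
          \<longlonglongrightarrow> (\<Sum>w\<in>A. (cmod (coord (X m) w - L w))\<^sup>2)"
        by (intro tendsto_intros L)
      have "(\<Sum>w\<in>A. (cmod (coord (X m) w - coord (X n) w))\<^sup>2) \<le> e\<^sup>2" if "n \<ge> K" for n
      proof -
        have "(\<Sum>w\<in>A. (cmod (coord (X m - X n) w))\<^sup>2) \<le> (norm (X m - X n))\<^sup>2"
          by (rule sum_coord_le_norm) fact
        also have "\<dots> \<le> e\<^sup>2"
          using K \<open>m \<ge> K\<close> \<open>n \<ge> K\<close> by (intro power_mono) (auto simp: dist_norm less_imp_le)
        finally show ?thesis
          by (simp add: minus_fock.rep_eq)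
      qed
      then show "\<exists>N. \<forall>n\<ge>N. (\<Sum>w\<in>A. (cmod (coord (X m) w - coord (X n) w))\<^sup>2) \<le> e\<^sup>2"
        by blast
    qed
    then show ?thesis
      by blast
  qed
  obtain K where K: "\<And>A. finite A \<Longrightarrow> (\<Sum>w\<in>A. (cmod (coord (X K) w - L w))\<^sup>2) \<le> 1\<^sup>2"
    using bound[of 1] by auto
  have "(\<lambda>w. (cmod (coord (X K) w - L w))\<^sup>2) summable_on UNIV"
    by (rule nonneg_bdd_above_summable_on) (use K in \<open>auto intro!: bdd_aboveI[of _ 1]\<close>)
  then have "(\<lambda>w. (cmod (- (coord (X K) w - L w)))\<^sup>2) summable_on UNIV"
    by (simp only: norm_minus_cancel)
  from ell2_add[OF coord_summable[of "X K"] this]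
  have "(\<lambda>w. (cmod (L w))\<^sup>2) summable_on UNIV"
    by simp
  then have L': "coord (Abs_fock L) = L"
    by (simp add: Abs_fock_inverse)
  have "X \<longlonglongrightarrow> Abs_fock L"
  proof (rule metric_LIMSEQ_I)
    fix e :: real
    assume "e > 0"
    then obtain K where
      K: "\<forall>m\<ge>K. \<forall>A. finite A \<longrightarrow> (\<Sum>w\<in>A. (cmod (coord (X m) w - L w))\<^sup>2) \<le> (e / 2)\<^sup>2"
      using bound[of "e / 2"] by auto
    have "norm (X m - Abs_fock L) \<le> e / 2" if "m \<ge> K" for m
      using K that \<open>e > 0\<close> by (intro norm_fock_le) (auto simp: minus_fock.rep_eq L')
    then show "\<exists>K. \<forall>m\<ge>K. dist (X m) (Abs_fock L) < e"
      using \<open>e > 0\<close> unfolding dist_norm by (intro exI[of _ K] allI impI) fastforce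
  qed
  then show "convergent X"
    by (rule convergentI)
qed

text \<open>
  The type \<open>'n fock \<Rightarrow>\<^sub>L 'n fock\<close> consists of the real-linear bounded operators. All operators
  used below are complex-linear, and their norm is the usual operator norm.
\<close>

lift_definition fock_scale :: "complex \<Rightarrow> 'n fock \<Rightarrow> 'n fock" is "\<lambda>c f w. c * f w"
  by (rule ell2_scale)

lemma norm_fock_scale: "norm (fock_scale c x) = cmod c * norm x"
  by (simp add: norm_fock_def fock_scale.rep_eq norm_mult power_mult_distrib
      infsum_cmult_right' real_sqrt_mult)

lift_definition scalar_op :: "complex \<Rightarrow> 'n fock \<Rightarrow>\<^sub>L 'n fock" is fock_scale
proof (rule bounded_linear_intro)
  fix c :: complex and x y :: "'n fock" and r :: real
  show "fock_scale c (x + y) = fock_scale c x + fock_scale c y"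
    by transfer (simp add: algebra_simps)
  show "fock_scale c (r *\<^sub>R x) = r *\<^sub>R fock_scale c x"
    by transfer (simp add: algebra_simps)
  show "norm (fock_scale c x) \<le> norm x * cmod c"
    by (simp add: norm_fock_scale)
qed

text \<open>In coordinates, \<open>\<xi> \<mapsto> e\<^sub>i \<otimes> \<xi>\<close> moves the coefficient of \<open>e\<^sub>\<alpha>\<close> to that of \<open>e\<^sub>i \<otimes> e\<^sub>\<alpha> = e\<^bsub>i#\<alpha>\<^esub>\<close>.\<close>

definition create_coord :: "'n \<Rightarrow> ('n list \<Rightarrow> complex) \<Rightarrow> 'n list \<Rightarrow> complex" where
  "create_coord i f w = (case w of [] \<Rightarrow> 0 | j # v \<Rightarrow> if j = i then f v else 0)"

lemma create_coord_simps [simp]: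
  "create_coord i f [] = 0"
  "create_coord i f (j # v) = (if j = i then f v else 0)"
  by (simp_all add: create_coord_def)

lemma create_coord_has_sum:
  assumes "((\<lambda>w. (cmod (f w))\<^sup>2) has_sum s) UNIV"
  shows "((\<lambda>w. (cmod (create_coord i f w))\<^sup>2) has_sum s) UNIV"
proof -
  have "((\<lambda>w. (cmod (create_coord i f w))\<^sup>2) has_sum s) (range ((#) i))"
    using assms by (subst has_sum_reindex) (auto simp: o_def)
  moreover have "(cmod (create_coord i f w))\<^sup>2 = 0" if "w \<notin> range ((#) i)" for w
    using that by (cases w) auto
  ultimately show ?thesis
    by (subst has_sum_cong_neutral[where T = "range ((#) i)"
          and g = "\<lambda>w. (cmod (create_coord i f w))\<^sup>2"]) auto
qed

lift_definition create :: "'n \<Rightarrow> 'n fock \<Rightarrow> 'n fock" is create_coord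
  by (rule has_sum_imp_summable, rule create_coord_has_sum, rule has_sum_infsum)

lemma norm_create: "norm (create i x) = norm x"
  unfolding norm_fock_def create.rep_eq
  by (simp only: infsumI[OF create_coord_has_sum[OF has_sum_infsum[OF coord_summable]]])

lift_definition creation :: "'n \<Rightarrow> 'n fock \<Rightarrow>\<^sub>L 'n fock" is create
proof (rule bounded_linear_intro)
  fix i :: 'n and x y :: "'n fock" and r :: real
  show "create i (x + y) = create i x + create i y"
    by (rule fock_eqI, case_tac w) (simp_all add: create.rep_eq plus_fock.rep_eq)
  show "create i (r *\<^sub>R x) = r *\<^sub>R create i x"
    by (rule fock_eqI, case_tac w) (simp_all add: create.rep_eq scaleR_fock.rep_eq)
  show "norm (create i x) \<le> norm x * 1"
    by (simp add: norm_create)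
qed

text \<open>The formal power series with coefficients \<open>a\<^sub>\<alpha>\<close> is represented by the family
  \<open>a :: 'n list \<Rightarrow> complex\<close>, with pointwise vector space operations.\<close>

definition series_scale :: "complex \<Rightarrow> ('n list \<Rightarrow> complex) \<Rightarrow> ('n list \<Rightarrow> complex)" where
  "series_scale c a = (\<lambda>\<alpha>. c * a \<alpha>)"

definition Hol_ball :: "('n::finite list \<Rightarrow> complex) set" where
  "Hol_ball =
    {a. limsup (\<lambda>k. ereal (root (2 * k) (\<Sum>\<alpha> | length \<alpha> = k. (cmod (a \<alpha>))\<^sup>2))) \<le> 1}"

primrec word_op :: "('n \<Rightarrow> 'n fock \<Rightarrow>\<^sub>L 'n fock) \<Rightarrow> 'n list \<Rightarrow> 'n fock \<Rightarrow>\<^sub>L 'n fock" where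
  "word_op X [] = id_blinfun"
| "word_op X (i # \<alpha>) = X i o\<^sub>L word_op X \<alpha>"

definition eval_series ::
    "('n::finite list \<Rightarrow> complex) \<Rightarrow> ('n \<Rightarrow> 'n fock \<Rightarrow>\<^sub>L 'n fock) \<Rightarrow> 'n fock \<Rightarrow>\<^sub>L 'n fock" where
  "eval_series a X = (\<Sum>k. \<Sum>\<alpha> | length \<alpha> = k. scalar_op (a \<alpha>) o\<^sub>L word_op X \<alpha>)"

definition radial_max :: "('n::finite list \<Rightarrow> complex) \<Rightarrow> real \<Rightarrow> real" where
  "radial_max a r = norm (eval_series a (\<lambda>i. r *\<^sub>R creation i))"

text \<open>The radial maximal function is defined on \<open>[0,1)\<close>, which differs from \<open>[0,1]\<close> by a null set.\<close>

definition radial_Hardy :: "real \<Rightarrow> ('n::finite list \<Rightarrow> complex) set" where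
  "radial_Hardy p = {a \<in> Hol_ball.
      radial_max a \<in> borel_measurable (lebesgue_on {0..<1}) \<and>
      set_integrable lebesgue {0..<1} (\<lambda>r. radial_max a r powr p)}"

definition radial_Hardy_norm :: "real \<Rightarrow> ('n::finite list \<Rightarrow> complex) \<Rightarrow> real" where
  "radial_Hardy_norm p a = (LINT r:{0..<1}|lebesgue. radial_max a r powr p) powr (1 / p)"

end

theory Submission
  imports Defs
begin

text \<open>Let \<open>A\<^sub>k\<close> be the \<open>\<ell>\<^sup>2\<close> norm of the coefficients of degree \<open>k\<close>. Words of equal length give creation
  operators with orthogonal ranges, so the degree \<open>k\<close> part of the series has operator norm at most
  \<open>A\<^sub>k\<close>; applying the series to the vacuum vector gives \<open>A\<^sub>k r\<^sup>k \<le> M(r)\<close>. Integrating the latter over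
  \<open>[s,1)\<close> bounds \<open>A\<^sub>k s\<^sup>k\<close> by a multiple of the Hardy norm, for every \<open>s < 1\<close>. Hence a Cauchy sequence
  converges coefficientwise to a free holomorphic function, its radial maximal functions converge
  pointwise on \<open>[0,1)\<close>, and Fatou's lemma turns this into convergence in norm.\<close>

subsection \<open>Degreewise coefficient norms\<close>

lemma coord_sum: "coord (sum f A) w = (\<Sum>i\<in>A. coord (f i) w)"
  by (induction A rule: infinite_finite_induct)
    (simp_all add: plus_fock.rep_eq zero_fock.rep_eq)

lemma cmod_coord_le_norm: "cmod (coord x w) \<le> norm x"
  by (rule power2_le_imp_le) (use sum_coord_le_norm[of "{w}" x] in simp_all)

lemma bounded_linear_coord: "bounded_linear (\<lambda>x. coord x w)"
  by (rule bounded_linear_intro[where K = 1])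
    (simp_all add: plus_fock.rep_eq scaleR_fock.rep_eq scaleR_conv_of_real cmod_coord_le_norm)

lemma finite_words: "finite {\<alpha> :: 'n::finite list. length \<alpha> = k}"
  using finite_lists_length_eq[of "UNIV :: 'n set" k] by simp

text \<open>Encoding the norm through \<open>L2_set\<close> makes Minkowski's inequality for finite
  families directly available in each degree.\<close>

definition coeff_norm :: "('n list \<Rightarrow> complex) \<Rightarrow> nat \<Rightarrow> real" where
  "coeff_norm a k = L2_set (\<lambda>\<alpha>. cmod (a \<alpha>)) {\<alpha>. length \<alpha> = k}"

lemma coeff_norm_nonneg: "0 \<le> coeff_norm a k"
  by (simp add: coeff_norm_def)

lemma coeff_norm_power2: "(coeff_norm a k)\<^sup>2 = (\<Sum>\<alpha> | length \<alpha> = k. (cmod (a \<alpha>))\<^sup>2)"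
  by (simp add: coeff_norm_def L2_set_def sum_nonneg)

text \<open>There are finitely many words of each length, so one term is at most the whole sum; over
  an infinite index set the sum would default to 0.\<close>

lemma cmod_le_coeff_norm: "cmod (a \<alpha>) \<le> coeff_norm a (length \<alpha>)"
  for a :: "'n::finite list \<Rightarrow> complex"
  unfolding coeff_norm_def
  by (rule member_le_L2_set[OF finite_words, of \<alpha> _ "\<lambda>\<alpha>. cmod (a \<alpha>)"]) simp

lemma coeff_norm_add: "coeff_norm (a + b) k \<le> coeff_norm a k + coeff_norm b k"
proof -
  have "coeff_norm (a + b) k
      \<le> L2_set (\<lambda>\<alpha>. cmod (a \<alpha>) + cmod (b \<alpha>)) {\<alpha>. length \<alpha> = k}"
    unfolding coeff_norm_def by (rule L2_set_mono) (simp_all add: norm_triangle_ineq)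
  also have "\<dots> \<le> coeff_norm a k + coeff_norm b k"
    unfolding coeff_norm_def by (rule L2_set_triangle_ineq)
  finally show ?thesis .
qed

lemma coeff_norm_scale: "coeff_norm (series_scale c a) k = cmod c * coeff_norm a k"
  by (simp add: coeff_norm_def series_scale_def norm_mult L2_set_right_distrib)

text \<open>Within one fixed degree the norm is continuous in its coefficients. This lets the limit
  series inherit bounds from a coefficientwise convergent sequence.\<close>

lemma tendsto_coeff_norm:
  assumes "\<And>\<alpha>. ((\<lambda>m. \<sigma> m \<alpha>) \<longlongrightarrow> a \<alpha>) F"
  shows "((\<lambda>m. coeff_norm (\<sigma> m) k) \<longlongrightarrow> coeff_norm a k) F"
  unfolding coeff_norm_def L2_set_def by (intro tendsto_intros assms)

text \<open>This is Cauchy-Hadamard: the limsup in the definition is the reciprocal of the radius of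
  convergence of the scalar series of degreewise norms.\<close>

lemma Hol_ball_iff_conv_radius: "a \<in> Hol_ball \<longleftrightarrow> 1 \<le> conv_radius (coeff_norm a)"
proof -
  define L where "L = limsup (\<lambda>k. ereal (root k (coeff_norm a k)))"
  \<comment> \<open>Degree 0 is no exception, because \<open>root 0\<close> is 0 on both
    sides.\<close>
  have "root (2 * k) (\<Sum>\<alpha> | length \<alpha> = k. (cmod (a \<alpha>))\<^sup>2) = root k (coeff_norm a k)" for k
    unfolding coeff_norm_power2[symmetric]
    by (simp add: mult.commute[of 2] real_root_mult_exp coeff_norm_nonneg flip: sqrt_def)
  then have "a \<in> Hol_ball \<longleftrightarrow> L \<le> 1"
    by (simp add: Hol_ball_def L_def)
  \<comment> \<open>The sign matters: for negative L the inverse would not be at least 1, although L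
    \<le> 1.\<close>
  moreover have "0 \<le> L"
    unfolding L_def by (rule le_Limsup)
      (auto simp: coeff_norm_nonneg intro!: always_eventually real_root_ge_zero)
  moreover have "conv_radius (coeff_norm a) = inverse L"
    by (simp add: conv_radius_def L_def coeff_norm_nonneg)
  ultimately show ?thesis
    by (cases L) (auto simp: one_ereal_def field_simps)
qed

text \<open>The working form of holomorphy: a series converges inside its radius of convergence, and
  convergence at every radius below 1 forces that radius to be at least 1.\<close>

lemma Hol_ball_iff_summable:
  "a \<in> Hol_ball \<longleftrightarrow> (\<forall>r\<in>{0..<1}. summable (\<lambda>k. coeff_norm a k * r ^ k))"
proof
  assume "a \<in> Hol_ball"
  then have R: "1 \<le> conv_radius (coeff_norm a)"
    by (simp add: Hol_ball_iff_conv_radius)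
  show "\<forall>r\<in>{0..<1}. summable (\<lambda>k. coeff_norm a k * r ^ k)"
  proof
    fix r :: real
    assume "r \<in> {0..<1}"
    then have "ereal (norm r) < 1"
      by simp
    then show "summable (\<lambda>k. coeff_norm a k * r ^ k)"
      using R by (intro summable_in_conv_radius) (rule less_le_trans)
  qed
next
  assume *: "\<forall>r\<in>{0..<1}. summable (\<lambda>k. coeff_norm a k * r ^ k)"
  have "1 \<le> conv_radius (coeff_norm a)"
  proof (rule conv_radius_geI_ex)
    fix r :: real
    assume "0 < r" "ereal r < 1"
    then show "\<exists>z. norm z = r \<and> summable (\<lambda>k. coeff_norm a k * z ^ k)"
      using * by (intro exI[of _ r]) simp
  qed
  then show "a \<in> Hol_ball"
    by (simp add: Hol_ball_iff_conv_radius)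
qed

section \<open>The vector space of formal series and its subspace of free holomorphic
  functions\<close>

lemma vector_space_series_scale: "vector_space series_scale"
  by unfold_locales (auto simp: series_scale_def fun_eq_iff algebra_simps)

lemma module_series_scale: "module series_scale"
  by (simp only: module_iff_vector_space vector_space_series_scale)

lemma subspace_Hol_ball: "module.subspace series_scale Hol_ball"
proof -
  interpret vector_space "series_scale :: complex \<Rightarrow> ('a list \<Rightarrow> complex) \<Rightarrow> _"
    by (rule vector_space_series_scale)
  show ?thesis
    unfolding subspace_def
  proof (intro conjI ballI allI)
    show "0 \<in> Hol_ball"
      by (simp add: Hol_ball_iff_summable coeff_norm_def L2_set_def)
  next
    fix a b :: "'a list \<Rightarrow> complex"
    assume ab: "a \<in> Hol_ball" "b \<in> Hol_ball"
    show "a + b \<in> Hol_ball"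
      unfolding Hol_ball_iff_summable
    proof
      fix r :: real
      assume r: "r \<in> {0..<1}"
      show "summable (\<lambda>k. coeff_norm (a + b) k * r ^ k)"
      proof (rule summable_comparison_test')
        show "summable (\<lambda>k. coeff_norm a k * r ^ k + coeff_norm b k * r ^ k)"
          using ab r by (intro summable_add) (auto simp: Hol_ball_iff_summable)
        show "norm (coeff_norm (a + b) k * r ^ k) \<le> coeff_norm a k * r ^ k + coeff_norm b k * r ^ k"
          for k
          using mult_right_mono[OF coeff_norm_add[of a b k], of "r ^ k"] r
          by (simp add: coeff_norm_nonneg distrib_right)
      qed
    qed
  next
    fix c and a :: "'a list \<Rightarrow> complex"
    assume "a \<in> Hol_ball"
    then show "series_scale c a \<in> Hol_ball"
      by (auto simp: Hol_ball_iff_summable coeff_norm_scale mult.assoc intro!: summable_mult)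
  qed
qed

subsection \<open>The radial maximal function\<close>

text \<open>A product of creation operators prepends \<alpha> to every basis word. The
  \<open>take\<close> condition tests whether \<alpha> is a prefix of w, and it fails when w is
  shorter than \<alpha>.\<close>

lemma coord_word_op_creation:
  "coord (word_op creation \<alpha> x) w =
    (if take (length \<alpha>) w = \<alpha> then coord x (drop (length \<alpha>) w) else 0)"
proof (induction \<alpha> arbitrary: w)
  case (Cons i \<alpha>)
  then show ?case
    by (cases w) (simp_all add: creation.rep_eq create.rep_eq)
qed simp

lemma word_op_scaleR: "word_op (\<lambda>i. r *\<^sub>R X i) \<alpha> = r ^ length \<alpha> *\<^sub>R word_op X \<alpha>"
  by (induction \<alpha>)
    (simp_all add: bounded_bilinear.scaleR_left[OF bounded_bilinear_blinfun_compose]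
      bounded_bilinear.scaleR_right[OF bounded_bilinear_blinfun_compose])

text \<open>The creation operators enter unscaled, so the operator does not depend on the
  radius.\<close>

definition homogeneous_part ::
    "('n::finite list \<Rightarrow> complex) \<Rightarrow> nat \<Rightarrow> 'n fock \<Rightarrow>\<^sub>L 'n fock" where
  "homogeneous_part a k = (\<Sum>\<alpha> | length \<alpha> = k. scalar_op (a \<alpha>) o\<^sub>L word_op creation \<alpha>)"

text \<open>A word w has only one prefix of length k, so at most one summand reaches it. This is the
  orthogonality of the ranges, read in coordinates.\<close>

lemma coord_homogeneous_part:
  "coord (homogeneous_part a k x) w =
    (if k \<le> length w then a (take k w) * coord x (drop k w) else 0)"
proof -
  have "coord (homogeneous_part a k x) w =
      (\<Sum>\<alpha> | length \<alpha> = k. a \<alpha> * coord (word_op creation \<alpha> x) w)"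
    by (simp add: homogeneous_part_def blinfun.sum_left coord_sum scalar_op.rep_eq
        fock_scale.rep_eq)
  also have "\<dots> = (\<Sum>\<alpha> | length \<alpha> = k. if take k w = \<alpha> then a (take k w) * coord x (drop k w) else 0)"
    by (rule sum.cong) (auto simp: coord_word_op_creation)
  \<comment> \<open>If w is shorter than k, then \<open>take k w\<close> is not among the indices
    and the sum vanishes.\<close>
  also have "\<dots> = (if k \<le> length w then a (take k w) * coord x (drop k w) else 0)"
    by (subst sum.delta'[OF finite_words]) auto
  finally show ?thesis .
qed

text \<open>Cutting a word after k letters is injective, so the squared coordinates are distinct
  terms of a product of two families: the degree k coefficients and the coordinates of x.\<close>

lemma norm_homogeneous_part_le: "norm (homogeneous_part a k) \<le> coeff_norm a k"
proof (rule norm_blinfun_bound[OF coeff_norm_nonneg], rule norm_fock_le)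
  fix x and A :: "'a list set"
  assume A: "finite A"
  have "(\<Sum>w\<in>A. (cmod (coord (homogeneous_part a k x) w))\<^sup>2) =
      (\<Sum>w\<in>{w\<in>A. k \<le> length w}. (cmod (a (take k w) * coord x (drop k w)))\<^sup>2)"
    using A by (intro sum.mono_neutral_cong_right) (auto simp: coord_homogeneous_part)
  also have "\<dots> = (\<Sum>(\<alpha>, v)\<in>(\<lambda>w. (take k w, drop k w)) ` {w\<in>A. k \<le> length w}.
      (cmod (a \<alpha>))\<^sup>2 * (cmod (coord x v))\<^sup>2)"
    by (subst sum.reindex)
      (auto intro!: inj_onI simp: norm_mult power_mult_distrib, metis append_take_drop_id)
  also have "\<dots> \<le> (\<Sum>(\<alpha>, v)\<in>{\<alpha>. length \<alpha> = k} \<times> drop k ` A. (cmod (a \<alpha>))\<^sup>2 * (cmod (coord x v))\<^sup>2)"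
    by (rule sum_mono2) (auto intro!: finite_words A)
  also have "\<dots> = (coeff_norm a k)\<^sup>2 * (\<Sum>v\<in>drop k ` A. (cmod (coord x v))\<^sup>2)"
    by (simp add: coeff_norm_power2 sum_product sum.cartesian_product)
  also have "\<dots> \<le> (coeff_norm a k)\<^sup>2 * (norm x)\<^sup>2"
    using A by (intro mult_left_mono sum_coord_le_norm) auto
  finally show "(\<Sum>w\<in>A. (cmod (coord (homogeneous_part a k x) w))\<^sup>2) \<le> (coeff_norm a k * norm x)\<^sup>2"
    by (simp add: power_mult_distrib)
qed (simp add: coeff_norm_nonneg)

lemma homogeneous_part_add:
  "homogeneous_part (a + b) k = homogeneous_part a k + homogeneous_part b k"
  by (rule blinfun_eqI, rule fock_eqI)
    (simp add: blinfun.add_left plus_fock.rep_eq coord_homogeneous_part distrib_right)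

text \<open>The operators form only a real vector space here, so a complex scalar acts by
  composition with \<open>scalar_op\<close>.\<close>

lemma homogeneous_part_scale:
  "homogeneous_part (series_scale c a) k = scalar_op c o\<^sub>L homogeneous_part a k"
  by (rule blinfun_eqI, rule fock_eqI)
    (simp add: scalar_op.rep_eq fock_scale.rep_eq coord_homogeneous_part series_scale_def)

lemma norm_scalar_op_le: "norm (scalar_op c) \<le> cmod c"
  by (rule norm_blinfun_bound) (simp_all add: scalar_op.rep_eq norm_fock_scale)

text \<open>All words of length k contribute the same factor \<open>r ^ k\<close>, which leaves a
  power series in r with operator coefficients.\<close>

lemma eval_series_radial:
  "eval_series a (\<lambda>i. r *\<^sub>R creation i) = (\<Sum>k. r ^ k *\<^sub>R homogeneous_part a k)"
proof -
  have "(\<Sum>\<alpha> | length \<alpha> = k. scalar_op (a \<alpha>) o\<^sub>L word_op (\<lambda>i. r *\<^sub>R creation i) \<alpha>) =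
      r ^ k *\<^sub>R homogeneous_part a k" for k
    unfolding homogeneous_part_def scaleR_sum_right
    by (rule sum.cong)
      (simp_all add: word_op_scaleR
        bounded_bilinear.scaleR_right[OF bounded_bilinear_blinfun_compose])
  then show ?thesis
    by (simp add: eval_series_def)
qed

lemma radial_norm_term_le:
  assumes "0 \<le> r"
  shows "norm (r ^ k *\<^sub>R homogeneous_part a k) \<le> coeff_norm a k * r ^ k"
  using mult_left_mono[OF norm_homogeneous_part_le[of a k], of "r ^ k"] assms
  by (simp add: mult.commute)

lemma summable_norm_radial:
  assumes "a \<in> Hol_ball" "r \<in> {0..<1}"
  shows "summable (\<lambda>k. norm (r ^ k *\<^sub>R homogeneous_part a k))"
proof (rule summable_comparison_test')
  show "summable (\<lambda>k. coeff_norm a k * r ^ k)"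
    using assms by (simp add: Hol_ball_iff_summable)
qed (use radial_norm_term_le[of r] assms(2) in simp)

lemma summable_radial:
  assumes "a \<in> Hol_ball" "r \<in> {0..<1}"
  shows "summable (\<lambda>k. r ^ k *\<^sub>R homogeneous_part a k)"
  by (rule summable_norm_cancel[OF summable_norm_radial[OF assms]])

lemma radial_max_nonneg: "0 \<le> radial_max a r"
  by (simp add: radial_max_def)

lemma radial_max_add_le:
  assumes "a \<in> Hol_ball" "b \<in> Hol_ball" "r \<in> {0..<1}"
  shows "radial_max (a + b) r \<le> radial_max a r + radial_max b r"
proof -
  have "eval_series (a + b) (\<lambda>i. r *\<^sub>R creation i) =
      eval_series a (\<lambda>i. r *\<^sub>R creation i) + eval_series b (\<lambda>i. r *\<^sub>R creation i)"
    unfolding eval_series_radial homogeneous_part_add scaleR_add_right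
    by (rule suminf_add[symmetric]) (intro summable_radial assms)+
  then show ?thesis
    by (simp add: radial_max_def norm_triangle_ineq)
qed

lemma radial_max_scale_le:
  fixes a :: "'n::finite list \<Rightarrow> complex"
  assumes "a \<in> Hol_ball" "r \<in> {0..<1}"
  shows "radial_max (series_scale c a) r \<le> cmod c * radial_max a r"
proof -
  have "eval_series (series_scale c a) (\<lambda>i. r *\<^sub>R creation i) =
      scalar_op c o\<^sub>L eval_series a (\<lambda>i. r *\<^sub>R creation i)"
    unfolding eval_series_radial homogeneous_part_scale
    using bounded_linear.suminf[OF bounded_bilinear.bounded_linear_right
        [OF bounded_bilinear_blinfun_compose] summable_radial[OF assms], of "scalar_op c"]
    by (simp add: bounded_bilinear.scaleR_right[OF bounded_bilinear_blinfun_compose])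
  then have "radial_max (series_scale c a) r \<le> norm (scalar_op c :: 'n fock \<Rightarrow>\<^sub>L _) * radial_max a r"
    by (simp add: radial_max_def norm_blinfun_compose)
  also have "\<dots> \<le> cmod c * radial_max a r"
    by (rule mult_right_mono[OF norm_scalar_op_le radial_max_nonneg])
  finally show ?thesis .
qed

lemma series_scale_Hol_ball: "a \<in> Hol_ball \<Longrightarrow> series_scale c a \<in> Hol_ball"
  by (rule module.subspace_scale[OF module_series_scale subspace_Hol_ball])

text \<open>For nonzero c the reverse inequality is the forward one applied to
  \<open>inverse c\<close>.\<close>

lemma radial_max_scale:
  assumes "a \<in> Hol_ball" "r \<in> {0..<1}"
  shows "radial_max (series_scale c a) r = cmod c * radial_max a r"
proof (cases "c = 0")
  case True
  then show ?thesis
    using radial_max_scale_le[OF assms, of c] radial_max_nonneg[of "series_scale c a" r] by simp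
next
  case False
  have "a = series_scale (inverse c) (series_scale c a)"
    using False by (simp add: series_scale_def fun_eq_iff)
  then have "radial_max a r \<le> cmod (inverse c) * radial_max (series_scale c a) r"
    using radial_max_scale_le[OF series_scale_Hol_ball[OF assms(1)] assms(2), of "inverse c" c]
    by simp
  from mult_left_mono[OF this norm_ge_zero[of c]]
  have "cmod c * radial_max a r \<le> radial_max (series_scale c a) r"
    using False by (simp add: norm_inverse mult.assoc[symmetric] del: mult_le_cancel_left)
  with radial_max_scale_le[OF assms, of c] show ?thesis
    by simp
qed

section \<open>Upper and lower bounds of the radial maximal function by coefficients\<close>

lemma radial_max_le_suminf:
  assumes "a \<in> Hol_ball" "r \<in> {0..<1}"
  shows "radial_max a r \<le> (\<Sum>k. coeff_norm a k * r ^ k)"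
proof -
  have "radial_max a r \<le> (\<Sum>k. norm (r ^ k *\<^sub>R homogeneous_part a k))"
    unfolding radial_max_def eval_series_radial
    by (rule summable_norm[OF summable_norm_radial[OF assms]])
  also have "\<dots> \<le> (\<Sum>k. coeff_norm a k * r ^ k)"
    using assms radial_norm_term_le[of r]
    by (intro suminf_le summable_norm_radial) (auto simp: Hol_ball_iff_summable)
  finally show ?thesis .
qed

lift_definition vacuum :: "'n fock" is "\<lambda>w. if w = [] then 1 else 0"
proof -
  have "(\<lambda>w :: 'n list. (cmod (if w = [] then 1 else 0))\<^sup>2) summable_on {[]}"
    by simp
  then show "(\<lambda>w :: 'n list. (cmod (if w = [] then 1 else 0))\<^sup>2) summable_on UNIV"
    by (rule summable_on_cong_neutral[THEN iffD1, rotated -1]) auto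
qed

lemma norm_vacuum_le: "norm (vacuum :: 'n fock) \<le> 1"
proof (rule norm_fock_le)
  fix A :: "'n list set"
  assume "finite A"
  have "(\<Sum>w\<in>A. (cmod (coord vacuum w))\<^sup>2) = (\<Sum>w\<in>A. if w = [] then 1 else 0)"
    by (rule sum.cong) (simp_all add: vacuum.rep_eq)
  also have "\<dots> \<le> 1\<^sup>2"
    using \<open>finite A\<close> by simp
  finally show "(\<Sum>w\<in>A. (cmod (coord vacuum w))\<^sup>2) \<le> 1\<^sup>2" .
qed simp

text \<open>Evaluating at the vacuum vector recovers the coefficients. This replaces the maximum principle,
  since the lower bound it gives is monotone in \<open>r\<close>.\<close>

lemma coeff_norm_le_radial_max:
  assumes "a \<in> Hol_ball" "r \<in> {0..<1}"
  shows "coeff_norm a k * r ^ k \<le> radial_max a r"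
proof -
  define T where "T = eval_series a (\<lambda>i. r *\<^sub>R creation i)"
  have coord_T: "coord (T vacuum) w = of_real (r ^ length w) * a w" for w
  proof -
    \<comment> \<open>Evaluation at the vacuum followed by a coordinate is continuous, so it can be
      applied to the series term by term.\<close>
    have "bounded_linear (\<lambda>T. coord (blinfun_apply T (vacuum :: 'a fock)) w)"
      by (rule bounded_linear_compose[OF bounded_linear_coord blinfun.bounded_linear_left])
    from bounded_linear.suminf[OF this summable_radial[OF assms]]
    have "coord (T vacuum) w = (\<Sum>k. coord ((r ^ k *\<^sub>R homogeneous_part a k) vacuum) w)"
      by (simp add: T_def eval_series_radial)
    \<comment> \<open>The vacuum only has a coordinate at the empty word, so a term survives only if
      \<open>drop k w\<close> is empty and k \<le> \<open>length w\<close>.\<close>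
    also have "\<dots> = (\<Sum>k. if k = length w then of_real (r ^ length w) * a w else 0)"
      by (rule suminf_cong)
        (auto simp: blinfun.scaleR_left scaleR_fock.rep_eq coord_homogeneous_part vacuum.rep_eq)
    also have "\<dots> = of_real (r ^ length w) * a w"
      by (subst suminf_finite[of "{length w}"]) simp_all
    finally show ?thesis .
  qed
  have "(coeff_norm a k * r ^ k)\<^sup>2 = (\<Sum>w | length w = k. (cmod (coord (T vacuum) w))\<^sup>2)"
    unfolding power_mult_distrib coeff_norm_power2 sum_distrib_right
    by (rule sum.cong)
      (use assms(2) in \<open>auto simp: coord_T norm_mult norm_power power_mult_distrib mult.commute\<close>)
  also have "\<dots> \<le> (norm (T vacuum))\<^sup>2"
    by (rule sum_coord_le_norm[OF finite_words])
  finally have "coeff_norm a k * r ^ k \<le> norm (T vacuum)"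
    by (rule power2_le_imp_le) simp
  also have "\<dots> \<le> norm T * norm (vacuum :: 'a fock)"
    by (rule norm_blinfun)
  also have "\<dots> \<le> norm T"
    using mult_left_mono[OF norm_vacuum_le norm_ge_zero[of T]] by simp
  finally show ?thesis
    by (simp add: radial_max_def T_def)
qed

subsection \<open>Fatou's lemma and Minkowski's inequality\<close>

text \<open>Fatou's lemma asks for no dominating function and also yields integrability of the
  limit. The bound is required only eventually, which suits the tail of a Cauchy sequence.\<close>

lemma integral_le_of_pointwise_limit:
  fixes f :: "nat \<Rightarrow> 'a \<Rightarrow> real"
  assumes f: "\<And>n. integrable M (f n)" "\<And>n x. x \<in> space M \<Longrightarrow> 0 \<le> f n x"
    and lim: "\<And>x. x \<in> space M \<Longrightarrow> (\<lambda>n. f n x) \<longlonglongrightarrow> g x"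
    and le: "eventually (\<lambda>n. integral\<^sup>L M (f n) \<le> C) sequentially"
  shows "integrable M g" "integral\<^sup>L M g \<le> C"
proof -
  have g_meas [measurable]: "g \<in> borel_measurable M"
    using lim by (rule borel_measurable_LIMSEQ_real) (use f in auto)
  have g_nonneg: "0 \<le> g x" if "x \<in> space M" for x
    by (rule LIMSEQ_le_const[OF lim[OF that]]) (use f(2)[OF that] in auto)
  \<comment> \<open>One instance of the bound shows that C is nonnegative, so that
    \<open>ennreal C\<close> does not truncate it to 0.\<close>
  obtain n where "integral\<^sup>L M (f n) \<le> C"
    using eventually_happens[OF le] by auto
  then have "0 \<le> C"
    using Bochner_Integration.integral_nonneg[of M "f n"] f(2) by (meson order_trans)
  have "(\<integral>\<^sup>+ x. ennreal (g x) \<partial>M) = (\<integral>\<^sup>+ x. liminf (\<lambda>n. ennreal (f n x)) \<partial>M)"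
  proof (rule nn_integral_cong)
    fix x
    assume "x \<in> space M"
    then have "(\<lambda>n. ennreal (f n x)) \<longlonglongrightarrow> ennreal (g x)"
      by (intro tendsto_ennrealI lim)
    then show "ennreal (g x) = liminf (\<lambda>n. ennreal (f n x))"
      by (simp add: lim_imp_Liminf)
  qed
  also have "\<dots> \<le> liminf (\<lambda>n. \<integral>\<^sup>+ x. ennreal (f n x) \<partial>M)"
    by (rule nn_integral_liminf) (use f(1) in measurable)
  also have "\<dots> = liminf (\<lambda>n. ennreal (integral\<^sup>L M (f n)))"
    using f by (simp add: nn_integral_eq_integral)
  also have "\<dots> \<le> limsup (\<lambda>n. ennreal (integral\<^sup>L M (f n)))"
    by (rule Liminf_le_Limsup) simp
  also have "\<dots> \<le> ennreal C"
    using le by (intro Limsup_bounded) (auto elim!: eventually_mono intro: ennreal_leI)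
  finally have le_C: "(\<integral>\<^sup>+ x. ennreal (g x) \<partial>M) \<le> ennreal C" .
  then show g_int: "integrable M g"
    using g_nonneg by (intro integrableI_nonneg) (auto intro: le_less_trans)
  then show "integral\<^sup>L M g \<le> C"
    using le_C g_nonneg \<open>0 \<le> C\<close> by (simp add: nn_integral_eq_integral)
qed

text \<open>The closed half-line is used because maximal functions may vanish. If an endpoint is 0,
  the claim reduces to \<open>t powr p\<close> \<le> t for 0 < t < 1.\<close>

lemma convex_on_powr: "convex_on {0..} (\<lambda>x::real. x powr p)" if "1 \<le> p" for p
proof -
  have *: "(t * y) powr p \<le> t * y powr p" if "0 < t" "t < 1" "0 \<le> y" for t y :: real
    using that \<open>1 \<le> p\<close> powr_mono'[of 1 p t] by (simp add: powr_mult mult_right_mono)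
  show ?thesis
  proof (rule convex_onI)
    fix t x y :: real
    assume t: "0 < t" "t < 1" and xy: "x \<in> {0..}" "y \<in> {0..}"
    consider "x = 0" | "y = 0" | "0 < x" "0 < y"
      using xy by fastforce
    then show "((1 - t) *\<^sub>R x + t *\<^sub>R y) powr p \<le> (1 - t) * x powr p + t * y powr p"
    proof cases
      case 3
      then show ?thesis
        using convex_onD[OF powr_convex[OF \<open>1 \<le> p\<close>], of t x y] t by simp
    qed (use *[of t y] *[of "1 - t" x] t xy \<open>1 \<le> p\<close> in auto)
  qed simp
qed

text \<open>Convexity of \<open>x powr p\<close> at the convex combination
  \<open>(f + g) / (F + G) = (F / (F + G)) (f / F) + (G / (F + G)) (g / G)\<close>.\<close>

lemma integral_powr_add_le:
  fixes f g h :: "'a \<Rightarrow> real"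
  assumes p: "1 \<le> p" and FG: "0 < F" "0 < G"
    and f: "integrable M (\<lambda>x. f x powr p)" "(\<integral>x. f x powr p \<partial>M) \<le> F powr p"
      "\<And>x. x \<in> space M \<Longrightarrow> 0 \<le> f x"
    and g: "integrable M (\<lambda>x. g x powr p)" "(\<integral>x. g x powr p \<partial>M) \<le> G powr p"
      "\<And>x. x \<in> space M \<Longrightarrow> 0 \<le> g x"
    and h: "h \<in> borel_measurable M" "\<And>x. x \<in> space M \<Longrightarrow> 0 \<le> h x"
      "\<And>x. x \<in> space M \<Longrightarrow> h x \<le> f x + g x"
  shows "integrable M (\<lambda>x. h x powr p)" "(\<integral>x. h x powr p \<partial>M) \<le> (F + G) powr p"
proof -
  define t where "t = G / (F + G)"
  define c where "c = (F + G) powr p"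
  \<comment> \<open>This majorant of \<open>h powr p\<close> serves twice: it dominates for
    integrability, and its integral is at most c.\<close>
  define u where "u x = c * ((1 - t) * (f x powr p / F powr p) + t * (g x powr p / G powr p))" for x
  have t: "0 \<le> t" "t \<le> 1" "(F + G) * (1 - t) = F" "(F + G) * t = G"
    using FG by (auto simp: t_def field_simps)
  have "0 \<le> c"
    by (simp add: c_def)
  have hu: "h x powr p \<le> u x" if "x \<in> space M" for x
  proof -
    have "f x + g x = (F + G) * (1 - t) * (f x / F) + (F + G) * t * (g x / G)"
      using FG unfolding t by simp
    then have "f x + g x = (F + G) * ((1 - t) * (f x / F) + t * (g x / G))"
      by (simp only: distrib_left mult.assoc)
    moreover have "0 \<le> (1 - t) * (f x / F) + t * (g x / G)"
      using t FG f(3)[OF that] g(3)[OF that] by simp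
    ultimately have "(f x + g x) powr p = c * ((1 - t) * (f x / F) + t * (g x / G)) powr p"
      using FG by (simp add: powr_mult c_def)
    also have "\<dots> \<le> c * ((1 - t) * (f x / F) powr p + t * (g x / G) powr p)"
      using convex_onD[OF convex_on_powr[OF p], of t "f x / F" "g x / G"] t FG
        f(3)[OF that] g(3)[OF that] by (intro mult_left_mono) (auto simp: c_def)
    also have "\<dots> = u x"
      using FG f(3)[OF that] g(3)[OF that] by (simp add: u_def powr_divide)
    finally show ?thesis
      using powr_mono2[of p "h x" "f x + g x"] h(2,3)[OF that] p by simp
  qed
  have u: "integrable M u"
    unfolding u_def using f(1) g(1) by auto
  show hp: "integrable M (\<lambda>x. h x powr p)"
    by (rule Bochner_Integration.integrable_bound[OF u])
      (use h(1) hu in \<open>auto intro!: AE_I2 order_trans[OF _ abs_ge_self]\<close>)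
  have "(\<integral>x. h x powr p \<partial>M) \<le> integral\<^sup>L M u"
    by (rule integral_mono[OF hp u hu])
  also have "\<dots> = c * ((1 - t) * ((\<integral>x. f x powr p \<partial>M) / F powr p) + t * ((\<integral>x. g x powr p \<partial>M) / G powr p))"
    unfolding u_def using f(1) g(1) by simp
  \<comment> \<open>Both normalised integrals are at most 1, and the weights add up to 1.\<close>
  also have "\<dots> \<le> c * ((1 - t) * 1 + t * 1)"
    using t FG f(2) g(2) \<open>0 \<le> c\<close> by (intro mult_left_mono add_mono) auto
  finally show "(\<integral>x. h x powr p \<partial>M) \<le> (F + G) powr p"
    by (simp add: c_def)
qed

subsection \<open>The radial Hardy space\<close>

text \<open>The partial sums are polynomials in r, so their norms are continuous and converge
  pointwise on [0,1).\<close>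

lemma radial_max_measurable:
  assumes "a \<in> Hol_ball"
  shows "radial_max a \<in> borel_measurable (lebesgue_on {0..<1})"
proof (rule borel_measurable_LIMSEQ_real)
  show "(\<lambda>N. norm (\<Sum>k<N. r ^ k *\<^sub>R homogeneous_part a k)) \<longlonglongrightarrow> radial_max a r"
    if "r \<in> space (lebesgue_on {0..<1})" for r
    unfolding radial_max_def eval_series_radial using that
    by (intro tendsto_norm summable_LIMSEQ summable_radial assms) simp
  show "(\<lambda>r. norm (\<Sum>k<N. r ^ k *\<^sub>R homogeneous_part a k)) \<in> borel_measurable (lebesgue_on {0..<1})"
    for N
    by (intro continuous_imp_measurable_on_sets_lebesgue continuous_intros) simp
qed

lemma radial_Hardy_iff:
  "a \<in> radial_Hardy p \<longleftrightarrow>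
    a \<in> Hol_ball \<and> integrable (lebesgue_on {0..<1}) (\<lambda>r. radial_max a r powr p)"
  using radial_max_measurable
  by (auto simp: radial_Hardy_def set_integrable_def integrable_restrict_space)

lemma radial_Hardy_norm_eq:
  "radial_Hardy_norm p a = (\<integral>r. radial_max a r powr p \<partial>lebesgue_on {0..<1}) powr (1 / p)"
  by (simp add: radial_Hardy_norm_def set_lebesgue_integral_def integral_restrict_space)

text \<open>Later norm estimates are made on the integral itself, free of the p-th root.\<close>

lemma radial_Hardy_norm_le_iff:
  assumes "0 < p" "0 \<le> e"
  shows "radial_Hardy_norm p a \<le> e \<longleftrightarrow> (\<integral>r. radial_max a r powr p \<partial>lebesgue_on {0..<1}) \<le> e powr p"
proof -
  define I where "I = (\<integral>r. radial_max a r powr p \<partial>lebesgue_on {0..<1})"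
  have "0 \<le> I"
    unfolding I_def by (rule Bochner_Integration.integral_nonneg) simp
  have "I powr (1 / p) \<le> e \<longleftrightarrow> (I powr (1 / p)) powr p \<le> e powr p"
    using assms powr_mono2[of p "I powr (1 / p)" e] powr_less_mono2[of p e "I powr (1 / p)"]
    by fastforce
  also have "(I powr (1 / p)) powr p = I"
    using assms \<open>0 \<le> I\<close> by (simp add: powr_powr)
  finally show ?thesis
    by (simp add: radial_Hardy_norm_eq I_def)
qed

lemma radial_Hardy_norm_nonneg: "0 \<le> radial_Hardy_norm p a"
  by (simp add: radial_Hardy_norm_def)

text \<open>The passage from the norm back to coefficients, behind both definiteness and
  coefficientwise convergence. The factor comes from the length 1 - s of [s,1).\<close>

lemma coeff_norm_le_radial_Hardy_norm:
  assumes p: "0 < p" and a: "a \<in> radial_Hardy p" and s: "0 < s" "s < 1"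
  shows "coeff_norm a k * s ^ k \<le> (1 - s) powr (- (1 / p)) * radial_Hardy_norm p a"
proof -
  let ?M = "lebesgue_on {0..<1::real}"
  define c where "c = coeff_norm a k * s ^ k"
  define N where "N = radial_Hardy_norm p a"
  have a': "a \<in> Hol_ball" "integrable ?M (\<lambda>r. radial_max a r powr p)"
    using a by (simp_all add: radial_Hardy_iff)
  have "0 \<le> c"
    using s by (simp add: c_def coeff_norm_nonneg)
  have "indicator {s..<1} r * c powr p \<le> radial_max a r powr p" if "r \<in> space ?M" for r
  proof (cases "s \<le> r")
    case True
    then have "c \<le> coeff_norm a k * r ^ k"
      unfolding c_def using s by (intro mult_left_mono power_mono coeff_norm_nonneg) auto
    also have "\<dots> \<le> radial_max a r"
      using that a' by (intro coeff_norm_le_radial_max) auto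
    finally show ?thesis
      using \<open>0 \<le> c\<close> p by (auto simp: indicator_def intro: powr_mono2)
  qed simp
  moreover have ind: "integrable ?M (\<lambda>r. indicator {s..<1} r * c powr p)"
    by (intro integrable_mult_left integrable_real_indicator)
      (use s in \<open>auto simp: sets_restrict_space_iff emeasure_restrict_space\<close>)
  ultimately have "(\<integral>r. indicator {s..<1} r * c powr p \<partial>?M) \<le> (\<integral>r. radial_max a r powr p \<partial>?M)"
    using a' by (intro integral_mono)
  moreover have "(\<integral>r. indicator {s..<1} r * c powr p \<partial>?M) = (1 - s) * c powr p"
    using s by (simp add: measure_restrict_space Int_absorb2)
  moreover have "(\<integral>r. radial_max a r powr p \<partial>?M) \<le> N powr p"
    using radial_Hardy_norm_le_iff[OF p radial_Hardy_norm_nonneg[of p a], of a] by (simp add: N_def)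
  ultimately have "(1 - s) * c powr p \<le> N powr p"
    by linarith
  then have "((1 - s) powr (1 / p) * c) powr p \<le> N powr p"
    using p s \<open>0 \<le> c\<close> by (simp add: powr_mult powr_powr)
  then have "(1 - s) powr (1 / p) * c \<le> N"
    using p radial_Hardy_norm_nonneg[of p a]
      powr_less_mono2[of p N "(1 - s) powr (1 / p) * c"] by (force simp: N_def)
  then show ?thesis
    unfolding c_def N_def using s by (simp add: powr_minus field_simps)
qed

section \<open>Norm axioms on the Hardy space\<close>

lemma radial_Hardy_add:
  assumes p: "1 \<le> p" and a: "a \<in> radial_Hardy p" and b: "b \<in> radial_Hardy p"
  shows "a + b \<in> radial_Hardy p"
    and "radial_Hardy_norm p (a + b) \<le> radial_Hardy_norm p a + radial_Hardy_norm p b"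
proof -
  let ?M = "lebesgue_on {0..<1::real}" and ?N = "radial_Hardy_norm p"
  have Hol: "a \<in> Hol_ball" "b \<in> Hol_ball"
    using a b by (simp_all add: radial_Hardy_iff)
  then have Hol_add: "a + b \<in> Hol_ball"
    by (rule module.subspace_add[OF module_series_scale subspace_Hol_ball])
  have *: "integrable ?M (\<lambda>r. radial_max (a + b) r powr p) \<and> ?N (a + b) \<le> ?N a + ?N b + e"
    if "0 < e" for e
  proof -
    \<comment> \<open>The slack e / 2 keeps both normalising constants positive even if a norm is 0;
      letting e tend to 0 removes it at the end.\<close>
    have FG: "0 < ?N a + e / 2" "0 < ?N b + e / 2"
      using that radial_Hardy_norm_nonneg[of p a] radial_Hardy_norm_nonneg[of p b] by simp_all
    have le: "(\<integral>r. radial_max x r powr p \<partial>?M) \<le> (?N x + e / 2) powr p" for x :: "'a list \<Rightarrow> complex"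
      using p that radial_Hardy_norm_nonneg[of p x]
      by (subst radial_Hardy_norm_le_iff[symmetric]) auto
    have int: "integrable ?M (\<lambda>r. radial_max a r powr p)" "integrable ?M (\<lambda>r. radial_max b r powr p)"
      using a b by (simp_all add: radial_Hardy_iff)
    have add: "radial_max (a + b) r \<le> radial_max a r + radial_max b r" if "r \<in> space ?M" for r
      by (rule radial_max_add_le[OF Hol]) (use that in simp)
    note sum = integral_powr_add_le[OF p FG int(1) le radial_max_nonneg int(2) le radial_max_nonneg
        radial_max_measurable[OF Hol_add] radial_max_nonneg add]
    have "integrable ?M (\<lambda>r. radial_max (a + b) r powr p)"
      by (rule sum)
    moreover have "(\<integral>r. radial_max (a + b) r powr p \<partial>?M) \<le> (?N a + e / 2 + (?N b + e / 2)) powr p"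
      by (rule sum)
    ultimately show ?thesis
      using radial_Hardy_norm_le_iff[of p "?N a + e / 2 + (?N b + e / 2)" "a + b"] p FG by simp
  qed
  show "a + b \<in> radial_Hardy p"
    using Hol_add *[of 1] by (simp add: radial_Hardy_iff)
  show "?N (a + b) \<le> ?N a + ?N b"
    by (rule field_le_epsilon) (rule conjunct2[OF *])
qed

lemma radial_Hardy_scale:
  assumes p: "0 < p" and a: "a \<in> radial_Hardy p"
  shows "series_scale c a \<in> radial_Hardy p"
    and "radial_Hardy_norm p (series_scale c a) = cmod c * radial_Hardy_norm p a"
proof -
  let ?M = "lebesgue_on {0..<1::real}"
  have a': "a \<in> Hol_ball" "integrable ?M (\<lambda>r. radial_max a r powr p)"
    using a by (simp_all add: radial_Hardy_iff)
  have eq: "radial_max (series_scale c a) r powr p = cmod c powr p * radial_max a r powr p"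
    if "r \<in> space ?M" for r
    using radial_max_scale[OF a'(1), of r c] that by (simp add: powr_mult radial_max_nonneg)
  have "integrable ?M (\<lambda>r. radial_max (series_scale c a) r powr p) \<longleftrightarrow>
      integrable ?M (\<lambda>r. cmod c powr p * radial_max a r powr p)"
    using eq by (intro Bochner_Integration.integrable_cong) auto
  then show "series_scale c a \<in> radial_Hardy p"
    using a' by (simp add: radial_Hardy_iff series_scale_Hol_ball)
  have "(\<integral>r. radial_max (series_scale c a) r powr p \<partial>?M) =
      cmod c powr p * (\<integral>r. radial_max a r powr p \<partial>?M)"
    using eq by (subst Bochner_Integration.integral_mult_right_zero[symmetric])
      (intro Bochner_Integration.integral_cong; simp)
  moreover have "0 \<le> (\<integral>r. radial_max a r powr p \<partial>?M)"
    by (rule Bochner_Integration.integral_nonneg) simp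
  ultimately show "radial_Hardy_norm p (series_scale c a) = cmod c * radial_Hardy_norm p a"
    using p by (simp add: radial_Hardy_norm_eq powr_mult powr_powr)
qed

lemma radial_max_zero: "radial_max (0 :: 'n::finite list \<Rightarrow> complex) r = 0"
proof -
  have "homogeneous_part (0 :: 'n list \<Rightarrow> complex) k = 0" for k
    by (rule blinfun_eqI, rule fock_eqI) (simp add: coord_homogeneous_part zero_fock.rep_eq)
  then show ?thesis
    by (simp add: radial_max_def eval_series_radial)
qed

lemma radial_Hardy_zero: "0 \<in> radial_Hardy p" "radial_Hardy_norm p 0 = 0"
  using module.subspace_0[OF module_series_scale subspace_Hol_ball]
  by (simp_all add: radial_Hardy_iff radial_Hardy_norm_eq radial_max_zero)

lemma radial_Hardy_norm_eq_0_iff: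
  assumes "0 < p" "a \<in> radial_Hardy p"
  shows "radial_Hardy_norm p a = 0 \<longleftrightarrow> a = 0"
proof
  assume "radial_Hardy_norm p a = 0"
  \<comment> \<open>Any radius strictly between 0 and 1 works; 1 / 2 is a choice.\<close>
  then have "coeff_norm a k \<le> 0" for k
    using coeff_norm_le_radial_Hardy_norm[OF assms, of "1 / 2" k]
    by (intro mult_right_le_imp_le[of _ "(1 / 2) ^ k" 0]) simp_all
  then have "cmod (a \<alpha>) \<le> 0" for \<alpha>
    using cmod_le_coeff_norm order_trans by blast
  then show "a = 0"
    by (simp add: fun_eq_iff)
qed (simp add: radial_Hardy_zero)

section \<open>Consequences of coefficient bounds at a larger radius\<close>

text \<open>The gap between r and s turns a bound uniform in the degree into a convergent geometric
  series of ratio r / s.\<close>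

lemma radial_max_le_of_coeff_bound:
  assumes b: "b \<in> Hol_ball" and r: "0 \<le> r" "r < s" "s < 1"
    and C: "\<And>k. coeff_norm b k * s ^ k \<le> C"
  shows "radial_max b r \<le> C * inverse (1 - r / s)"
proof -
  have "norm (r / s) < 1"
    using r by simp
  from sums_mult[OF geometric_sums[OF this], of C]
  have "(\<lambda>k. C * (r / s) ^ k) sums (C * inverse (1 - r / s))"
    by (simp only: inverse_eq_divide)
  moreover have "coeff_norm b k * r ^ k \<le> C * (r / s) ^ k" for k
    using mult_right_mono[OF C[of k], of "(r / s) ^ k"] r by (simp add: power_divide)
  moreover have "summable (\<lambda>k. coeff_norm b k * r ^ k)"
    using b r by (simp add: Hol_ball_iff_summable)
  ultimately have "(\<Sum>k. coeff_norm b k * r ^ k) \<le> C * inverse (1 - r / s)"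
    by (intro sums_le[OF _ summable_sums])
  then show ?thesis
    using radial_max_le_suminf[OF b, of r] r by simp
qed

lemma Hol_ball_of_coeff_bound:
  assumes "\<And>s. 0 < s \<Longrightarrow> s < 1 \<Longrightarrow> \<exists>C. \<forall>k. coeff_norm b k * s ^ k \<le> C"
  shows "b \<in> Hol_ball"
  unfolding Hol_ball_iff_summable
proof
  fix r :: real
  assume r: "r \<in> {0..<1}"
  \<comment> \<open>The midpoint of r and 1 leaves room on both sides and is positive even for r =
    0.\<close>
  define s where "s = (1 + r) / 2"
  have s: "0 < s" "s < 1" "r < s"
    using r by (auto simp: s_def)
  then obtain C where C: "\<And>k. coeff_norm b k * s ^ k \<le> C"
    using assms by blast
  show "summable (\<lambda>k. coeff_norm b k * r ^ k)"
  proof (rule summable_comparison_test')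
    show "summable (\<lambda>k. C * (r / s) ^ k)"
      using r s by (intro summable_mult[OF summable_geometric]) simp
    show "norm (coeff_norm b k * r ^ k) \<le> C * (r / s) ^ k" for k
      using mult_right_mono[OF C[of k], of "(r / s) ^ k"] r s
      by (simp add: power_divide coeff_norm_nonneg)
  qed
qed

section \<open>Subspace property and completeness\<close>

lemma series_scale_minus_one: "series_scale (- 1) a = - a"
  by (simp add: series_scale_def fun_eq_iff)

lemma subspace_radial_Hardy:
  assumes "1 \<le> p"
  shows "module.subspace series_scale (radial_Hardy p)"
proof -
  interpret vector_space "series_scale :: complex \<Rightarrow> ('a list \<Rightarrow> complex) \<Rightarrow> _"
    by (rule vector_space_series_scale)
  show ?thesis
    unfolding subspace_def
    using assms by (simp add: radial_Hardy_zero(1) radial_Hardy_add(1) radial_Hardy_scale(1))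
qed

lemma radial_max_minus_commute:
  assumes "a - b \<in> Hol_ball" "r \<in> {0..<1}"
  shows "radial_max (b - a) r = radial_max (a - b) r"
  using radial_max_scale[OF assms, of "- 1"] by (simp add: series_scale_minus_one)

lemma radial_Hardy_complete:
  fixes \<sigma> :: "nat \<Rightarrow> 'n::finite list \<Rightarrow> complex"
  assumes p: "1 \<le> p" and \<sigma>: "\<And>k. \<sigma> k \<in> radial_Hardy p"
    and Cauchy: "\<And>e. e > 0 \<Longrightarrow> \<exists>K. \<forall>k\<ge>K. \<forall>m\<ge>K. radial_Hardy_norm p (\<sigma> k - \<sigma> m) < e"
  shows "\<exists>a\<in>radial_Hardy p. (\<lambda>k. radial_Hardy_norm p (\<sigma> k - a)) \<longlonglongrightarrow> 0"
proof -
  interpret vector_space "series_scale :: complex \<Rightarrow> ('n list \<Rightarrow> complex) \<Rightarrow> _"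
    by (rule vector_space_series_scale)
  let ?M = "lebesgue_on {0..<1::real}" and ?N = "radial_Hardy_norm p"
  \<comment> \<open>The constant of the coefficient estimate. It is unbounded as s tends to 1, so
    the estimate is used at fixed radii and Fatou's lemma handles the whole interval.\<close>
  define D where "D s = (1 - s) powr (- (1 / p))" for s
  have diff: "\<sigma> l - \<sigma> m \<in> radial_Hardy p" for l m
    using \<sigma> p by (intro subspace_diff subspace_radial_Hardy)
  have coeff: "coeff_norm (\<sigma> l - \<sigma> m) k * s ^ k \<le> D s * ?N (\<sigma> l - \<sigma> m)"
    if "0 < s" "s < 1" for l m k s
    unfolding D_def by (rule coeff_norm_le_radial_Hardy_norm) (use p diff that in auto)
  have D_pos: "0 < D s" if "s < 1" for s
    using that by (simp add: D_def)

  have "Cauchy (\<lambda>m. \<sigma> m \<alpha>)" for \<alpha>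
    unfolding Cauchy_def
  proof (intro allI impI)
    fix e :: real
    assume "0 < e"
    \<comment> \<open>The coefficient estimate at s = 1 / 2, with the power of s moved to the other
      side.\<close>
    define q where "q = D (1 / 2) * 2 ^ length \<alpha>"
    have "0 < q"
      using D_pos[of "1 / 2"] by (simp add: q_def)
    then obtain K where K: "\<And>l m. l \<ge> K \<Longrightarrow> m \<ge> K \<Longrightarrow> ?N (\<sigma> l - \<sigma> m) < e / q"
      using Cauchy[of "e / q"] \<open>0 < e\<close> by auto
    have "dist (\<sigma> l \<alpha>) (\<sigma> m \<alpha>) < e" if "l \<ge> K" "m \<ge> K" for l m
    proof -
      have "dist (\<sigma> l \<alpha>) (\<sigma> m \<alpha>) \<le> coeff_norm (\<sigma> l - \<sigma> m) (length \<alpha>)"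
        using cmod_le_coeff_norm[of "\<sigma> l - \<sigma> m" \<alpha>] by (simp add: dist_norm)
      also have "\<dots> \<le> q * ?N (\<sigma> l - \<sigma> m)"
        using coeff[of "1 / 2" l m "length \<alpha>"] by (simp add: q_def field_simps)
      also have "\<dots> < e"
        using K[OF that] \<open>0 < q\<close> by (simp add: field_simps)
      finally show ?thesis .
    qed
    then show "\<exists>K. \<forall>l\<ge>K. \<forall>m\<ge>K. dist (\<sigma> l \<alpha>) (\<sigma> m \<alpha>) < e"
      by blast
  qed
  then have "\<exists>l. (\<lambda>m. \<sigma> m \<alpha>) \<longlonglongrightarrow> l" for \<alpha>
    using Cauchy_convergent convergent_def by blast
  then obtain a where a: "\<And>\<alpha>. (\<lambda>m. \<sigma> m \<alpha>) \<longlonglongrightarrow> a \<alpha>"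
    by metis

  \<comment> \<open>Letting l tend to infinity in each degree keeps the bound, with a constant
    independent of k.\<close>
  have coeff_limit: "coeff_norm (\<sigma> m - a) k * s ^ k \<le> D s * e"
    if K: "\<And>l m. l \<ge> K \<Longrightarrow> m \<ge> K \<Longrightarrow> ?N (\<sigma> l - \<sigma> m) < e" and "m \<ge> K" "0 < s" "s < 1" for K m k e s
  proof (rule LIMSEQ_le_const2)
    show "(\<lambda>l. coeff_norm (\<sigma> m - \<sigma> l) k * s ^ k) \<longlonglongrightarrow> coeff_norm (\<sigma> m - a) k * s ^ k"
      by (intro tendsto_intros tendsto_coeff_norm) (auto intro!: tendsto_intros a)
    have "coeff_norm (\<sigma> m - \<sigma> l) k * s ^ k \<le> D s * e" if "l \<ge> K" for l
    proof -
      have "coeff_norm (\<sigma> m - \<sigma> l) k * s ^ k \<le> D s * ?N (\<sigma> m - \<sigma> l)"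
        by (rule coeff) fact+
      also have "\<dots> \<le> D s * e"
        using K[OF \<open>m \<ge> K\<close> that] D_pos[OF \<open>s < 1\<close>] by simp
      finally show ?thesis .
    qed
    then show "\<exists>K. \<forall>l\<ge>K. coeff_norm (\<sigma> m - \<sigma> l) k * s ^ k \<le> D s * e"
      by blast
  qed

  have Hol_\<sigma>: "\<sigma> m \<in> Hol_ball" for m
    using \<sigma> by (simp add: radial_Hardy_iff)
  \<comment> \<open>Tolerance 1 suffices: the coefficient bounds put \<open>\<sigma> K - a\<close>
    in \<open>Hol_ball\<close>, and subtracting it from \<open>\<sigma> K\<close> recovers
    a.\<close>
  obtain K where K: "\<And>l m. l \<ge> K \<Longrightarrow> m \<ge> K \<Longrightarrow> ?N (\<sigma> l - \<sigma> m) < 1"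
    using Cauchy[of 1] by auto
  have a_eq: "\<sigma> K - (\<sigma> K - a) = a"
    by (simp add: fun_eq_iff)
  have "\<sigma> K - a \<in> Hol_ball"
    by (rule Hol_ball_of_coeff_bound) (use coeff_limit[OF K order_refl] in blast)
  then have "\<sigma> K - (\<sigma> K - a) \<in> Hol_ball"
    by (rule subspace_diff[OF subspace_Hol_ball Hol_\<sigma>])
  then have Hol_a: "a \<in> Hol_ball"
    unfolding a_eq .
  have Hol_diff: "\<sigma> m - a \<in> Hol_ball" "a - \<sigma> m \<in> Hol_ball" for m
    by (intro subspace_diff subspace_Hol_ball Hol_\<sigma> Hol_a)+

  have max_0: "(\<lambda>l. radial_max (\<sigma> l - a) r) \<longlonglongrightarrow> 0" if r: "r \<in> {0..<1}" for r
  proof (rule LIMSEQ_I)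
    fix e :: real
    assume "0 < e"
    define s where "s = (1 + r) / 2"
    have s: "0 < s" "s < 1" "r < s"
      using r by (auto simp: s_def)
    \<comment> \<open>The product of the constants of the coefficient bound at s and of the
      geometric series; tolerance \<open>e / 2 / q\<close> then leaves e / 2.\<close>
    define q where "q = D s * inverse (1 - r / s)"
    have "0 < q"
      using s D_pos[of s] by (simp add: q_def)
    then obtain K where K: "\<And>l m. l \<ge> K \<Longrightarrow> m \<ge> K \<Longrightarrow> ?N (\<sigma> l - \<sigma> m) < e / 2 / q"
      using Cauchy[of "e / 2 / q"] \<open>0 < e\<close> by auto
    have "norm (radial_max (\<sigma> l - a) r - 0) < e" if "l \<ge> K" for l
    proof -
      have "radial_max (\<sigma> l - a) r \<le> D s * (e / 2 / q) * inverse (1 - r / s)"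
        using r s by (intro radial_max_le_of_coeff_bound Hol_diff coeff_limit[OF K \<open>l \<ge> K\<close>]) auto
      also have "\<dots> = q * (e / 2 / q)"
        by (simp add: q_def)
      also have "\<dots> < e"
        using \<open>0 < q\<close> \<open>0 < e\<close> by simp
      finally show ?thesis
        by (simp add: radial_max_nonneg)
    qed
    then show "\<exists>K. \<forall>l\<ge>K. norm (radial_max (\<sigma> l - a) r - 0) < e"
      by blast
  qed
  have max_lim: "(\<lambda>l. radial_max (\<sigma> m - \<sigma> l) r) \<longlonglongrightarrow> radial_max (\<sigma> m - a) r"
    if r: "r \<in> {0..<1}" for m r
  proof (rule Lim_transform_bound[THEN LIM_zero_cancel, OF _ max_0[OF r]])
    have Hol: "\<sigma> m - \<sigma> l \<in> Hol_ball" for l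
      by (intro subspace_diff subspace_Hol_ball Hol_\<sigma>)
    \<comment> \<open>Together with the next two facts this gives the reverse triangle inequality
      for the maximal function at r.\<close>
    have 1: "radial_max (\<sigma> m - \<sigma> l) r \<le> radial_max (\<sigma> m - a) r + radial_max (a - \<sigma> l) r" for l
      using radial_max_add_le[OF Hol_diff(1) Hol_diff(2) r, of m l] by simp
    have 2: "radial_max (\<sigma> m - a) r \<le> radial_max (\<sigma> m - \<sigma> l) r + radial_max (\<sigma> l - a) r" for l
      using radial_max_add_le[OF Hol Hol_diff(1) r, of l l] by simp
    have 3: "radial_max (a - \<sigma> l) r = radial_max (\<sigma> l - a) r" for l
      by (rule radial_max_minus_commute[OF Hol_diff(1) r])
    have "\<bar>radial_max (\<sigma> m - \<sigma> l) r - radial_max (\<sigma> m - a) r\<bar> \<le> radial_max (\<sigma> l - a) r" for l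
      using 1[of l] 2[of l] 3[of l] by linarith
    then show "\<forall>\<^sub>F l in sequentially. norm (radial_max (\<sigma> m - \<sigma> l) r - radial_max (\<sigma> m - a) r)
        \<le> norm (radial_max (\<sigma> l - a) r)"
      by (simp add: radial_max_nonneg)
  qed

  \<comment> \<open>Fatou with m fixed and l tending to infinity: the tail bound on the differences
    survives as a non-strict bound.\<close>
  have limit: "\<sigma> m - a \<in> radial_Hardy p \<and> ?N (\<sigma> m - a) \<le> e"
    if K: "\<And>l m. l \<ge> K \<Longrightarrow> m \<ge> K \<Longrightarrow> ?N (\<sigma> l - \<sigma> m) < e" and "m \<ge> K" "0 < e" for K m e
  proof -
    have 1: "integrable ?M (\<lambda>r. radial_max (\<sigma> m - \<sigma> l) r powr p)" for l
      using diff by (simp add: radial_Hardy_iff)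
    have 2: "(\<lambda>l. radial_max (\<sigma> m - \<sigma> l) r powr p) \<longlonglongrightarrow> radial_max (\<sigma> m - a) r powr p"
      if "r \<in> space ?M" for r
      using that p by (intro tendsto_powr2 max_lim) (auto simp: radial_max_nonneg)
    have 3: "\<forall>\<^sub>F l in sequentially. (\<integral>r. radial_max (\<sigma> m - \<sigma> l) r powr p \<partial>?M) \<le> e powr p"
      using eventually_ge_at_top[of K]
    proof eventually_elim
      case (elim l)
      then show ?case
        using K[OF \<open>m \<ge> K\<close>, of l] p \<open>0 < e\<close> by (subst radial_Hardy_norm_le_iff[symmetric]) auto
    qed
    show ?thesis
      using integral_le_of_pointwise_limit[OF 1 _ 2 3] p \<open>0 < e\<close> Hol_diff(1)[of m]
      by (auto simp: radial_Hardy_iff radial_Hardy_norm_le_iff)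
  qed
  have "\<sigma> K - (\<sigma> K - a) \<in> radial_Hardy p"
    by (rule subspace_diff[OF subspace_radial_Hardy[OF p] \<sigma>
        conjunct1[OF limit[OF K order_refl zero_less_one]]])
  then have "a \<in> radial_Hardy p"
    unfolding a_eq .
  moreover have "(\<lambda>m. ?N (\<sigma> m - a)) \<longlonglongrightarrow> 0"
  proof (rule LIMSEQ_I)
    fix e :: real
    \<comment> \<open>Half of e restores strictness, since \<open>limit\<close> only gives
      \<le>.\<close>
    assume "0 < e"
    then obtain K where "\<And>l m. l \<ge> K \<Longrightarrow> m \<ge> K \<Longrightarrow> ?N (\<sigma> l - \<sigma> m) < e / 2"
      using Cauchy[of "e / 2"] by auto
    from limit[OF this] have "?N (\<sigma> m - a) < e" if "m \<ge> K" for m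
      using that \<open>0 < e\<close> by fastforce
    then show "\<exists>K. \<forall>m\<ge>K. norm (?N (\<sigma> m - a) - 0) < e"
      by (auto simp: radial_Hardy_norm_nonneg)
  qed
  ultimately show ?thesis
    by blast
qed

theorem theorem7p1:
  fixes p :: real
  assumes "p \<ge> 1"
  shows "complex_banach_space_on series_scale
    (radial_Hardy p :: ('n::finite list \<Rightarrow> complex) set) (radial_Hardy_norm p)"
proof -
  have "0 < p"
    using assms by simp
  interpret vector_space "series_scale :: complex \<Rightarrow> ('n list \<Rightarrow> complex) \<Rightarrow> _"
    by (rule vector_space_series_scale)
  show ?thesis
  proof
    show "subspace (radial_Hardy p :: ('n list \<Rightarrow> complex) set)"
      by (rule subspace_radial_Hardy[OF assms])
  qed (use assms \<open>0 < p\<close> in \<open>auto intro: radial_Hardy_norm_nonneg radial_Hardy_add(2) radial_Hardy_scale(2)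
      radial_Hardy_complete simp: radial_Hardy_norm_eq_0_iff\<close>)
qed

end
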